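(* Let $\tau>0$ and $H=L^2(\mathbb{R})$. If $\lambda_0,\lambda\in L^\infty(\mathbb{R})$ and $u_0\in C([-\tau,0];H)$, then there exists a unique solution $u\in C([-\tau,+\infty);H)$ of the problem $$\begin{cases} u_t(x,t)+u_{xxx}(x,t)-u_{xx}(x,t)+\lambda_0(x)u(x,t)+\lambda(x)u(x,t-\tau)=0 & \text{in } \mathbb{R}\times(0,\infty),\\ u(x,s)=u_0(x,s) & \text{in } \mathbb{R}\times[-\tau,0]. \end{cases}$$
   Context: All functions are real-valued. The operator $A_{\lambda_0}u:=-u_{xxx}+u_{xx}-\lambda_0u$ with domain $\mathcal{D}(A_{\lambda_0})=H^3(\mathbb{R})$ generates a strongly continuous semigroup $(S(t))_{t\ge0}$ in $H=L^2(\mathbb{R})$ (known). A solution of the problem is understood in the mild (semigroup) sense: $u=u_0$ on $[-\tau,0]$ and $$u(t)=S(t)u_0(0)-\int_0^tS(t-s)\lambda u(s-\tau)\,ds\quad\text{for all } t\ge0.$$ *)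

theory Defs
  imports "HOL-Analysis.Analysis"
begin

section \<open>The Hilbert space of square integrable functions on the real line\<close>

definition square_integrable :: "(real \<Rightarrow> real) \<Rightarrow> bool" where
  "square_integrable f \<longleftrightarrow>
     f \<in> borel_measurable lebesgue \<and> integrable lebesgue (\<lambda>x. (f x)\<^sup>2)"

lemma square_integrable_mult:
  assumes "square_integrable f" "square_integrable g"
  shows "integrable lebesgue (\<lambda>x. f x * g x)"
proof (rule Bochner_Integration.integrable_bound)
  show "integrable lebesgue (\<lambda>x. (f x)\<^sup>2 + (g x)\<^sup>2)"
    using assms by (auto simp: square_integrable_def)
  show "(\<lambda>x. f x * g x) \<in> borel_measurable lebesgue"
    using assms by (auto simp: square_integrable_def)
  have "norm (a * b) \<le> norm (a\<^sup>2 + b\<^sup>2)" for a b :: real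
  proof -
    have "2 * (\<bar>a\<bar> * \<bar>b\<bar>) \<le> a\<^sup>2 + b\<^sup>2"
      using sum_squares_bound[of "\<bar>a\<bar>" "\<bar>b\<bar>"] by simp
    moreover have "0 \<le> \<bar>a\<bar> * \<bar>b\<bar>" by simp
    ultimately have "\<bar>a\<bar> * \<bar>b\<bar> \<le> a\<^sup>2 + b\<^sup>2" by linarith
    then show ?thesis by (simp add: abs_mult)
  qed
  then show "AE x in lebesgue. norm (f x * g x) \<le> norm ((f x)\<^sup>2 + (g x)\<^sup>2)"
    by blast
qed

lemma square_integrable_zero: "square_integrable (\<lambda>x. 0)"
  by (simp add: square_integrable_def)

lemma square_integrable_add:
  assumes "square_integrable f" "square_integrable g"
  shows "square_integrable (\<lambda>x. f x + g x)"
proof -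
  have "integrable lebesgue (\<lambda>x. (f x)\<^sup>2 + (g x)\<^sup>2 + 2 * (f x * g x))"
    using assms square_integrable_mult[OF assms]
    by (auto simp: square_integrable_def)
  then show ?thesis
    using assms by (auto simp: square_integrable_def power2_sum mult.assoc)
qed

lemma square_integrable_scale:
  assumes "square_integrable f"
  shows "square_integrable (\<lambda>x. c * f x)"
  using assms by (auto simp: square_integrable_def power_mult_distrib)

lemma square_integrable_uminus:
  assumes "square_integrable f"
  shows "square_integrable (\<lambda>x. - f x)"
  using square_integrable_scale[OF assms, of "-1"] by simp

lemma square_integrable_diff:
  assumes "square_integrable f" "square_integrable g"
  shows "square_integrable (\<lambda>x. f x - g x)"
  using square_integrable_add[OF assms(1) square_integrable_uminus[OF assms(2)]] by simp

definition L2_rel :: "(real \<Rightarrow> real) \<Rightarrow> (real \<Rightarrow> real) \<Rightarrow> bool" where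
  "L2_rel f g \<longleftrightarrow>
     square_integrable f \<and> square_integrable g \<and> (AE x in lebesgue. f x = g x)"

quotient_type L2 = "real \<Rightarrow> real" / partial: L2_rel
proof (rule part_equivpI)
  show "\<exists>f. L2_rel f f"
    using square_integrable_zero by (auto simp: L2_rel_def)
  show "symp L2_rel"
    by (auto simp: symp_def L2_rel_def elim: AE_mp)
  show "transp L2_rel"
    by (auto simp: transp_def L2_rel_def elim!: eventually_elim2)
qed

instantiation L2 :: real_inner
begin

lift_definition zero_L2 :: L2 is "\<lambda>x. 0"
  by (simp add: L2_rel_def square_integrable_zero)

lift_definition plus_L2 :: "L2 \<Rightarrow> L2 \<Rightarrow> L2" is "\<lambda>f g x. f x + g x"
  by (auto simp: L2_rel_def square_integrable_add elim!: eventually_elim2)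

lift_definition uminus_L2 :: "L2 \<Rightarrow> L2" is "\<lambda>f x. - f x"
  by (auto simp: L2_rel_def square_integrable_uminus)

lift_definition minus_L2 :: "L2 \<Rightarrow> L2 \<Rightarrow> L2" is "\<lambda>f g x. f x - g x"
  by (auto simp: L2_rel_def square_integrable_diff elim!: eventually_elim2)

lift_definition scaleR_L2 :: "real \<Rightarrow> L2 \<Rightarrow> L2" is "\<lambda>c f x. c * f x"
  by (auto simp: L2_rel_def square_integrable_scale elim!: eventually_mono)

lift_definition inner_L2 :: "L2 \<Rightarrow> L2 \<Rightarrow> real" is "\<lambda>f g. LINT x|lebesgue. f x * g x"
proof -
  fix f f' g g' :: "real \<Rightarrow> real"
  assume a: "L2_rel f f'" "L2_rel g g'"
  show "(LINT x|lebesgue. f x * g x) = (LINT x|lebesgue. f' x * g' x)"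
  proof (rule integral_cong_AE)
    show "(\<lambda>x. f x * g x) \<in> borel_measurable lebesgue"
      "(\<lambda>x. f' x * g' x) \<in> borel_measurable lebesgue"
      using a by (auto simp: L2_rel_def square_integrable_def)
    show "AE x in lebesgue. f x * g x = f' x * g' x"
      using a by (auto simp: L2_rel_def elim!: eventually_elim2)
  qed
qed

definition norm_L2 :: "L2 \<Rightarrow> real" where "norm_L2 f = sqrt (inner f f)"
definition dist_L2 :: "L2 \<Rightarrow> L2 \<Rightarrow> real" where "dist_L2 f g = norm (f - g)"
definition sgn_L2 :: "L2 \<Rightarrow> L2" where "sgn_L2 f = inverse (norm f) *\<^sub>R f"
definition uniformity_L2 :: "(L2 \<times> L2) filter" where
  "uniformity_L2 = (INF e\<in>{0<..}. principal {(f, g). dist f g < e})"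
definition open_L2 :: "L2 set \<Rightarrow> bool" where
  "open_L2 U \<longleftrightarrow> (\<forall>x\<in>U. eventually (\<lambda>(x', y). x' = x \<longrightarrow> y \<in> U) uniformity)"

instance
proof
  fix f g h :: L2 and a b :: real
  show "dist f g = norm (f - g)" by (rule dist_L2_def)
  show "sgn f = inverse (norm f) *\<^sub>R f" by (rule sgn_L2_def)
  show "uniformity = (INF e\<in>{0<..}. principal {(f :: L2, g). dist f g < e})"
    by (rule uniformity_L2_def)
  show "open U \<longleftrightarrow> (\<forall>x\<in>U. eventually (\<lambda>(x', y). x' = x \<longrightarrow> y \<in> U) uniformity)"
    for U :: "L2 set" by (rule open_L2_def)
  show "norm f = sqrt (inner f f)" by (rule norm_L2_def)
  show "f + g + h = f + (g + h)"
    by transfer (simp add: L2_rel_def add.assoc square_integrable_add)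
  show "f + g = g + f"
    by transfer (simp add: L2_rel_def add.commute square_integrable_add)
  show "0 + f = f" by transfer (simp add: L2_rel_def)
  show "- f + f = 0" by transfer (simp add: L2_rel_def square_integrable_zero)
  show "f - g = f + - g"
    by transfer (simp add: L2_rel_def square_integrable_diff)
  show "a *\<^sub>R (f + g) = a *\<^sub>R f + a *\<^sub>R g"
    by transfer
       (simp add: L2_rel_def distrib_left square_integrable_add square_integrable_scale)
  show "(a + b) *\<^sub>R f = a *\<^sub>R f + b *\<^sub>R f"
    by transfer
       (simp add: L2_rel_def distrib_right square_integrable_add square_integrable_scale)
  show "a *\<^sub>R b *\<^sub>R f = (a * b) *\<^sub>R f"
    by transfer (simp add: L2_rel_def square_integrable_scale mult.assoc)
  show "1 *\<^sub>R f = f" by transfer (simp add: L2_rel_def)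
  show "inner f g = inner g f" by transfer (simp add: mult.commute)
  show "inner (f + g) h = inner f h + inner g h"
    by transfer (simp add: L2_rel_def distrib_right square_integrable_mult)
  show "inner (a *\<^sub>R f) g = a * inner f g"
    by transfer (simp add: L2_rel_def mult.assoc)
  show "0 \<le> inner f f" by transfer simp
  show "inner f f = 0 \<longleftrightarrow> f = 0"
  proof transfer
    fix f :: "real \<Rightarrow> real" assume "L2_rel f f"
    then have "square_integrable f" by (simp add: L2_rel_def)
    moreover from this have "integrable lebesgue (\<lambda>x. f x * f x)"
      by (intro square_integrable_mult)
    ultimately show "(LINT x|lebesgue. f x * f x) = 0 \<longleftrightarrow> L2_rel f (\<lambda>x. 0)"
      by (simp add: integral_nonneg_eq_0_iff_AE L2_rel_def square_integrable_zero)
  qed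
qed

end

lemma L2_exhaust:
  obtains f where "square_integrable f" "F = abs_L2 f"
  by (metis L2_rel_def Quotient3_L2 Quotient3_abs_rep Quotient3_rep_reflp)

lemma abs_L2_diff:
  assumes "square_integrable f" "square_integrable g"
  shows "abs_L2 f - abs_L2 g = abs_L2 (\<lambda>x. f x - g x)"
  using assms by (intro minus_L2.abs_eq) (auto simp: L2_rel_def)

lemma norm_abs_L2_power2:
  assumes "square_integrable f"
  shows "(norm (abs_L2 f))\<^sup>2 = (LINT x|lebesgue. (f x)\<^sup>2)"
    and "ennreal ((norm (abs_L2 f))\<^sup>2) = (\<integral>\<^sup>+x. ennreal ((f x)\<^sup>2) \<partial>lebesgue)"
proof -
  have "inner (abs_L2 f) (abs_L2 f) = (LINT x|lebesgue. f x * f x)"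
    using assms by (intro inner_L2.abs_eq) (auto simp: L2_rel_def)
  then show *: "(norm (abs_L2 f))\<^sup>2 = (LINT x|lebesgue. (f x)\<^sup>2)"
    unfolding power2_norm_eq_inner by (simp add: power2_eq_square)
  show "ennreal ((norm (abs_L2 f))\<^sup>2) = (\<integral>\<^sup>+x. ennreal ((f x)\<^sup>2) \<partial>lebesgue)"
    unfolding * using assms
    by (intro nn_integral_eq_integral[symmetric]) (auto simp: square_integrable_def)
qed

text \<open>Riesz--Fischer.\<close>

instance L2 :: banach
proof
  fix X :: "nat \<Rightarrow> L2" assume X: "Cauchy X"
  have "\<exists>N. \<forall>m\<ge>N. \<forall>n\<ge>N. norm (X m - X n) < (1/2)^k" for k :: nat
    using X by (auto simp: Cauchy_iff)
  then obtain N where N: "\<And>k m n. m \<ge> N k \<Longrightarrow> n \<ge> N k \<Longrightarrow> norm (X m - X n) < (1/2)^k"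
    by metis
  define r where "r = rec_nat (N 0) (\<lambda>k m. max (Suc m) (N (Suc k)))"
  have r_Suc: "r (Suc k) = max (Suc (r k)) (N (Suc k))" for k by (simp add: r_def)
  have "strict_mono r" by (simp add: strict_mono_Suc_iff r_Suc less_max_iff_disj)
  have rN: "r k \<ge> N k" for k by (cases k) (simp_all add: r_def)
  have dr: "norm (X (r (Suc k)) - X (r k)) < (1/2)^k" for k
    using rN[of k] strict_monoD[OF \<open>strict_mono r\<close>, of k "Suc k"] by (intro N) auto
  have "\<exists>f. square_integrable f \<and> X n = abs_L2 f" for n by (metis L2_exhaust)
  then obtain f where f: "\<And>n. square_integrable (f n)" "\<And>n. X n = abs_L2 (f n)"
    by metis
  have [measurable]: "f n \<in> borel_measurable lebesgue" for n
    using f(1)[of n] by (simp add: square_integrable_def)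
  have nn: "(\<integral>\<^sup>+x. ennreal ((f m x - f n x)\<^sup>2) \<partial>lebesgue) = ennreal ((norm (X m - X n))\<^sup>2)" for m n
    using norm_abs_L2_power2(2)[OF square_integrable_diff[OF f(1) f(1), of m n]]
    by (simp add: f abs_L2_diff)

  define d where "d k x = f (r (Suc k)) x - f (r k) x" for k x
  have [measurable]: "d k \<in> borel_measurable lebesgue" for k
    unfolding d_def by measurable
  have "(\<integral>\<^sup>+x. (\<Sum>k. ennreal (2^k * (d k x)\<^sup>2)) \<partial>lebesgue)
      = (\<Sum>k. \<integral>\<^sup>+x. ennreal (2^k * (d k x)\<^sup>2) \<partial>lebesgue)"
    by (intro nn_integral_suminf) measurable
  also have "\<dots> \<le> (\<Sum>k. ennreal ((1/2)^k))"
  proof (intro suminf_le)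
    fix k
    have "(\<integral>\<^sup>+x. ennreal (2^k * (d k x)\<^sup>2) \<partial>lebesgue)
        = ennreal (2^k) * (\<integral>\<^sup>+x. ennreal ((d k x)\<^sup>2) \<partial>lebesgue)"
      by (subst nn_integral_cmult[symmetric]) (auto simp: ennreal_mult)
    also have "\<dots> = ennreal (2^k * (norm (X (r (Suc k)) - X (r k)))\<^sup>2)"
      by (simp add: d_def nn ennreal_mult)
    also have "\<dots> \<le> ennreal ((1/2)^k)"
    proof (rule ennreal_leI)
      have "(norm (X (r (Suc k)) - X (r k)))\<^sup>2 \<le> ((1/2)^k)\<^sup>2"
        using dr[of k] by (intro power_mono) auto
      then have "2^k * (norm (X (r (Suc k)) - X (r k)))\<^sup>2 \<le> 2^k * ((1/2)^k)\<^sup>2"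
        by (intro mult_left_mono) auto
      also have "\<dots> = (1/2::real)^k"
        by (simp add: power2_eq_square power_one_over)
      finally show "2^k * (norm (X (r (Suc k)) - X (r k)))\<^sup>2 \<le> (1/2)^k" .
    qed
    finally show "(\<integral>\<^sup>+x. ennreal (2^k * (d k x)\<^sup>2) \<partial>lebesgue) \<le> ennreal ((1/2)^k)" .
  qed auto
  also have "\<dots> = ennreal (\<Sum>k. (1/2)^k)"
    by (intro suminf_ennreal2 summable_geometric) auto
  also have "\<dots> < \<infinity>" by simp
  finally have fin: "(\<integral>\<^sup>+x. (\<Sum>k. ennreal (2^k * (d k x)\<^sup>2)) \<partial>lebesgue) < \<infinity>" .
  have "AE x in lebesgue. (\<Sum>k. ennreal (2^k * (d k x)\<^sup>2)) \<noteq> \<infinity>"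
  proof (rule nn_integral_PInf_AE)
    show "(\<lambda>x. \<Sum>k. ennreal (2^k * (d k x)\<^sup>2)) \<in> borel_measurable lebesgue"
      by measurable
  qed (use fin in simp)
  then have conv: "AE x in lebesgue. convergent (\<lambda>k. f (r k) x)"
  proof eventually_elim
    fix x assume "(\<Sum>k. ennreal (2^k * (d k x)\<^sup>2)) \<noteq> \<infinity>"
    then have "summable (\<lambda>k. 2^k * (d k x)\<^sup>2)"
      by (intro summable_suminf_not_top) auto
    then have "summable (\<lambda>k. (1/2)^k + 2^k * (d k x)\<^sup>2)"
      by (intro summable_add summable_geometric) auto
    then have "summable (\<lambda>k. d k x)"
    proof (rule summable_comparison_test[rotated], intro exI allI impI)
      fix k
      define s where "s = sqrt (2^k)"
      have s: "s > 0" "s\<^sup>2 = 2^k" by (simp_all add: s_def)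
      have "2 * (1/s) * (s * \<bar>d k x\<bar>) \<le> (1/s)\<^sup>2 + (s * \<bar>d k x\<bar>)\<^sup>2"
        by (rule sum_squares_bound)
      then have "2 * \<bar>d k x\<bar> \<le> (1/2)^k + 2^k * (d k x)\<^sup>2"
        using s by (simp add: power_mult_distrib power_divide power_one_over)
      then show "norm (d k x) \<le> (1/2)^k + 2^k * (d k x)\<^sup>2"
        by simp
    qed
    then have "convergent (\<lambda>n. \<Sum>k<n. d k x)"
      by (simp add: summable_iff_convergent)
    then have "convergent (\<lambda>n. f (r n) x - f (r 0) x)"
      using sum_lessThan_telescope[of "\<lambda>k. f (r k) x"] by (simp add: d_def)
    then have "convergent (\<lambda>n. f (r n) x - f (r 0) x + f (r 0) x)"
      by (intro convergent_add convergent_const)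
    then show "convergent (\<lambda>k. f (r k) x)" by simp
  qed

  define g where "g x = lim (\<lambda>k. f (r k) x)" for x
  have [measurable]: "g \<in> borel_measurable lebesgue"
    unfolding g_def by (intro borel_measurable_lim_metric) measurable
  have lim_g: "AE x in lebesgue. (\<lambda>k. f (r k) x) \<longlonglongrightarrow> g x"
    using conv unfolding g_def by eventually_elim (simp add: convergent_LIMSEQ_iff)
  have bound: "(\<integral>\<^sup>+x. ennreal ((g x - f n x)\<^sup>2) \<partial>lebesgue) \<le> ennreal (c\<^sup>2)"
    if c: "c \<ge> 0" "\<And>m. m \<ge> M \<Longrightarrow> norm (X m - X n) \<le> c" for n M and c :: real
  proof -
    have "(\<integral>\<^sup>+x. ennreal ((g x - f n x)\<^sup>2) \<partial>lebesgue)
        = (\<integral>\<^sup>+x. liminf (\<lambda>k. ennreal ((f (r k) x - f n x)\<^sup>2)) \<partial>lebesgue)"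
      using lim_g
    proof (intro nn_integral_cong_AE, eventually_elim)
      fix x assume "(\<lambda>k. f (r k) x) \<longlonglongrightarrow> g x"
      then have "(\<lambda>k. ennreal ((f (r k) x - f n x)\<^sup>2)) \<longlonglongrightarrow> ennreal ((g x - f n x)\<^sup>2)"
        by (intro tendsto_intros)
      then show "ennreal ((g x - f n x)\<^sup>2) = liminf (\<lambda>k. ennreal ((f (r k) x - f n x)\<^sup>2))"
        by (intro lim_imp_Liminf[symmetric]) auto
    qed
    also have "\<dots> \<le> liminf (\<lambda>k. \<integral>\<^sup>+x. ennreal ((f (r k) x - f n x)\<^sup>2) \<partial>lebesgue)"
      by (intro nn_integral_liminf) measurable
    also have "\<dots> \<le> liminf (\<lambda>k. ennreal (c\<^sup>2))"
    proof (intro Liminf_mono eventually_sequentiallyI[of M])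
      fix k assume "M \<le> k"
      also have "k \<le> r k" by (rule strict_mono_imp_increasing[OF \<open>strict_mono r\<close>])
      finally show "(\<integral>\<^sup>+x. ennreal ((f (r k) x - f n x)\<^sup>2) \<partial>lebesgue) \<le> ennreal (c\<^sup>2)"
        unfolding nn using c by (intro ennreal_leI power_mono) auto
    qed
    also have "\<dots> = ennreal (c\<^sup>2)" by (simp add: Liminf_const)
    finally show ?thesis .
  qed
  have "(\<integral>\<^sup>+x. ennreal ((g x - f (N 0) x)\<^sup>2) \<partial>lebesgue) \<le> ennreal (1\<^sup>2)"
    using N[of 0 _ "N 0"] by (intro bound[of _ "N 0"]) (auto intro: less_imp_le)
  then have "(\<integral>\<^sup>+x. ennreal ((g x - f (N 0) x)\<^sup>2) \<partial>lebesgue) < \<infinity>"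
    by (rule le_less_trans) simp
  then have "square_integrable (\<lambda>x. g x - f (N 0) x)"
    by (auto simp: square_integrable_def integrable_iff_bounded)
  from square_integrable_add[OF this f(1)[of "N 0"]] have g: "square_integrable g" by simp
  have "X \<longlonglongrightarrow> abs_L2 g"
  proof (rule LIMSEQ_I)
    fix e :: real assume "0 < e"
    with X obtain M where M: "\<And>m n. m \<ge> M \<Longrightarrow> n \<ge> M \<Longrightarrow> norm (X m - X n) < e / 2"
      unfolding Cauchy_iff by (meson half_gt_zero)
    show "\<exists>M. \<forall>n\<ge>M. norm (X n - abs_L2 g) < e"
    proof (intro exI allI impI)
      fix n assume "n \<ge> M"
      then have "(\<integral>\<^sup>+x. ennreal ((g x - f n x)\<^sup>2) \<partial>lebesgue) \<le> ennreal ((e/2)\<^sup>2)"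
        using M \<open>0 < e\<close> by (intro bound[of _ M]) (auto intro: less_imp_le)
      then have "ennreal ((norm (abs_L2 g - X n))\<^sup>2) \<le> ennreal ((e/2)\<^sup>2)"
        using norm_abs_L2_power2(2)[OF square_integrable_diff[OF g f(1), of n]]
        by (simp add: f abs_L2_diff g)
      then have "norm (abs_L2 g - X n) \<le> e/2"
        using \<open>0 < e\<close> by (simp add: power2_le_iff_abs_le)
      then show "norm (X n - abs_L2 g) < e"
        using \<open>0 < e\<close> by (simp add: norm_minus_commute)
    qed
  qed
  then show "convergent X" by (auto simp: convergent_def)
qed


section \<open>Bounded multipliers and weak derivatives\<close>

definition L_infty :: "(real \<Rightarrow> real) set" where
  "L_infty = {a \<in> borel_measurable lebesgue. \<exists>C. AE x in lebesgue. \<bar>a x\<bar> \<le> C}"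

text \<open>Only meaningful for \<open>a \<in> L_infty\<close>; otherwise the product need not be
  square integrable and the value is unspecified.\<close>

definition mult_L2 :: "(real \<Rightarrow> real) \<Rightarrow> L2 \<Rightarrow> L2" where
  "mult_L2 a f = abs_L2 (\<lambda>x. a x * rep_L2 f x)"

definition test_function :: "(real \<Rightarrow> real) \<Rightarrow> bool" where
  "test_function \<phi> \<longleftrightarrow>
     (\<forall>n x. (deriv ^^ n) \<phi> differentiable (at x)) \<and> (\<exists>R. \<forall>x. R < \<bar>x\<bar> \<longrightarrow> \<phi> x = 0)"

definition weak_deriv :: "nat \<Rightarrow> L2 \<Rightarrow> L2 \<Rightarrow> bool" where
  "weak_deriv k f g \<longleftrightarrow>
     (\<forall>\<phi>. test_function \<phi> \<longrightarrow>
        (LINT x|lebesgue. rep_L2 f x * (deriv ^^ k) \<phi> x)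
        = (-1) ^ k * (LINT x|lebesgue. rep_L2 g x * \<phi> x))"

definition H3 :: "L2 set" where
  "H3 = {f. \<forall>k\<in>{1..3}. \<exists>g. weak_deriv k f g}"

text \<open>The unbounded operator \<open>u \<mapsto> - u''' + u'' - a u\<close> with domain \<open>H3\<close>, given by its
  graph; weak derivatives are unique as elements of \<open>L2\<close>, so this relation is single-valued.\<close>

definition A_op :: "(real \<Rightarrow> real) \<Rightarrow> (L2 \<times> L2) set" where
  "A_op a = {(u, - u3 + u2 - mult_L2 a u) | u u2 u3.
               u \<in> H3 \<and> weak_deriv 2 u u2 \<and> weak_deriv 3 u u3}"


section \<open>Strongly continuous semigroups and mild solutions\<close>

text \<open>Only the values at nonnegative times are relevant.\<close>

definition C0_semigroup ::
    "(real \<Rightarrow> ('a::real_normed_vector \<Rightarrow>\<^sub>L 'a)) \<Rightarrow> bool" where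
  "C0_semigroup S \<longleftrightarrow>
     S 0 = id_blinfun \<and>
     (\<forall>s\<ge>0. \<forall>t\<ge>0. S (s + t) = S s o\<^sub>L S t) \<and>
     (\<forall>f. ((\<lambda>t. S t f) \<longlongrightarrow> f) (at_right 0))"

text \<open>The infinitesimal generator as a graph: its domain is the set of \<open>f\<close> for which the
  limit exists.\<close>

definition generator ::
    "(real \<Rightarrow> ('a::real_normed_vector \<Rightarrow>\<^sub>L 'a)) \<Rightarrow> ('a \<times> 'a) set" where
  "generator S = {(f, g). ((\<lambda>h. (S h f - f) /\<^sub>R h) \<longlongrightarrow> g) (at_right 0)}"

text \<open>Mild solutions in \<open>C([-\<tau>, \<infinity>); L2)\<close> of
  \<open>u\<^sub>t + u\<^sub>x\<^sub>x\<^sub>x - u\<^sub>x\<^sub>x + \<lambda>\<^sub>0 u + \<lambda> u(t - \<tau>) = 0\<close>, \<open>u = u\<^sub>0\<close> on \<open>[-\<tau>, 0]\<close>. The coefficient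
  \<open>\<lambda>\<^sub>0\<close> enters through the semigroup \<open>S\<close>. The values of \<open>u\<close> below \<open>-\<tau>\<close> are irrelevant.\<close>

definition mild_solution ::
    "(real \<Rightarrow> (L2 \<Rightarrow>\<^sub>L L2)) \<Rightarrow> (real \<Rightarrow> real) \<Rightarrow> real \<Rightarrow> (real \<Rightarrow> L2) \<Rightarrow> (real \<Rightarrow> L2) \<Rightarrow> bool" where
  "mild_solution S lam \<tau> u0 u \<longleftrightarrow>
     continuous_on {-\<tau>..} u \<and>
     (\<forall>s\<in>{-\<tau>..0}. u s = u0 s) \<and>
     (\<forall>t\<ge>0. u t = S t (u0 0) - integral {0..t} (\<lambda>s. S (t - s) (mult_L2 lam (u (s - \<tau>)))))"

end

theory Submission
  imports Defs
begin

text \<open>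
  The equation is solved by the method of steps. In the Duhamel formula for \<open>u t\<close> the unknown enters
  only through \<open>u (s - \<tau>)\<close> with \<open>0 \<le> s \<le> t\<close>, that is, through values of \<open>u\<close> at times at most
  \<open>t - \<tau>\<close>. Hence once \<open>u\<close> is known up to time \<open>n * \<tau>\<close>, the formula is no longer an equation but
  an explicit expression for \<open>u\<close> up to time \<open>(n + 1) * \<tau>\<close>. Induction on \<open>n\<close> then gives both
  existence (\<open>delay_equation_existence\<close>) and uniqueness (\<open>delay_equation_uniqueness\<close>), without
  any smallness or contraction argument. Both hold for every strongly continuous semigroup on a
  Banach space and every bounded linear delay operator \<open>B\<close>; here \<open>B\<close> is multiplication by the
  bounded coefficient \<open>\<lambda>\<close> (\<open>bounded_linear_mult_L2\<close>).

  The analytic content is that a step preserves continuity: if \<open>g\<close> is continuous, then so is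
  \<open>t \<mapsto> S t f - \<integral>\<^sub>0\<^sup>t S (t - s) (g s) ds\<close> (\<open>continuous_on_duhamel\<close>). This needs the joint
  continuity of \<open>(t, x) \<mapsto> S t x\<close>, which the definition of a strongly continuous semigroup does not
  contain: it only gives right continuity of each orbit at time \<open>0\<close>. The gap is closed by the
  uniform boundedness principle, which turns that pointwise convergence into a bound on
  \<open>norm (S t)\<close> for \<open>t\<close> in compact intervals.
\<close>

section \<open>The uniform boundedness principle\<close>

text \<open>Baire's theorem gives a ball \<open>ball x e\<close> on which all the operators are bounded by one number
  \<open>n\<close>; by linearity, differences of points of this ball cover a neighbourhood of \<open>0\<close>.\<close>

lemma uniform_boundedness:
  fixes T :: "'i \<Rightarrow> 'a::banach \<Rightarrow>\<^sub>L 'b::real_normed_vector"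
  assumes bdd: "\<And>x. bounded (range (\<lambda>i. T i x))"
  shows "\<exists>M. \<forall>i. norm (T i) \<le> M"
proof -
  define F where "F n = {x. \<forall>i. norm (T i x) \<le> real n}" for n :: nat
  have closed_F: "closed (F n)" for n
  proof -
    have "F n = (\<Inter>i. {x. norm (T i x) \<le> real n})"
      by (auto simp: F_def)
    then show ?thesis
      by (auto intro!: closed_INT closed_Collect_le continuous_intros)
  qed
  have "x \<in> \<Union> (range F)" for x
  proof -
    obtain b where "\<And>i. norm (T i x) \<le> b"
      using bdd[of x] by (auto simp: bounded_iff)
    then have "x \<in> F (nat \<lceil>b\<rceil>)"
      unfolding F_def by (auto intro: order_trans real_nat_ceiling_ge)
    then show ?thesis by blast
  qed
  then have UN: "\<Union> (range F) = UNIV" by blast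
  have "\<exists>n. interior (F n) \<noteq> {}"
  proof (rule ccontr)
    assume "\<not> ?thesis"
    then have "euclidean interior_of \<Union> (range F) = {}"
      using closed_F
      by (intro Baire_category_alt disjI1 completely_metrizable_space_euclidean) auto
    then show False by (simp add: UN)
  qed
  then obtain n x where "x \<in> interior (F n)" by blast
  then obtain e where e: "e > 0" "ball x e \<subseteq> F n"
    unfolding mem_interior by blast
  have "norm (T i) \<le> 4 * real n / e" for i
  proof (rule norm_blinfun_bound)
    show "0 \<le> 4 * real n / e" using e by simp
    fix y
    show "norm (T i y) \<le> 4 * real n / e * norm y"
    proof (cases "y = 0")
      case False
      \<comment> \<open>\<open>y\<close> rescaled to have norm \<open>e / 2\<close>, so that \<open>x\<close> and \<open>x + z\<close> both lie in the ball.\<close>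
      define z where "z = (e / (2 * norm y)) *\<^sub>R y"
      have "norm z = e / 2" using False e by (simp add: z_def)
      then have "x \<in> F n" "x + z \<in> F n"
        using e by (auto simp: dist_norm)
      then have "norm (T i x) \<le> n" "norm (T i (x + z)) \<le> n"
        by (auto simp: F_def)
      moreover have "T i z = T i (x + z) - T i x"
        by (simp add: blinfun.add_right)
      ultimately have "norm (T i z) \<le> 2 * real n"
        using norm_triangle_ineq4[of "T i (x + z)" "T i x"] by simp
      moreover have "norm (T i z) = e / (2 * norm y) * norm (T i y)"
        using e by (simp add: z_def blinfun.scaleR_right)
      ultimately show ?thesis
        using False e by (simp add: field_simps)
    qed simp
  qed
  then show ?thesis by blast
qed

section \<open>Strong continuity of semigroups in both variables\<close>

lemma C0_semigroupD:
  assumes "C0_semigroup S"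
  shows "S 0 = id_blinfun"
    and "\<And>s t f. 0 \<le> s \<Longrightarrow> 0 \<le> t \<Longrightarrow> S (s + t) f = S s (S t f)"
    and "\<And>f. ((\<lambda>t. S t f) \<longlongrightarrow> f) (at_right 0)"
  using assms by (auto simp: C0_semigroup_def)

text \<open>If the norms were unbounded near \<open>0\<close>, there would be times \<open>t n \<longlonglongrightarrow> 0\<close> with
  \<open>norm (S (t n)) > n\<close>; but \<open>S (t n) f\<close> converges to \<open>f\<close> and so is bounded for every \<open>f\<close>,
  which contradicts uniform boundedness.\<close>

lemma C0_semigroup_bounded_near_0:
  fixes S :: "real \<Rightarrow> 'a::banach \<Rightarrow>\<^sub>L 'a"
  assumes S: "C0_semigroup S"
  obtains d M where "d > 0" "\<And>t. 0 \<le> t \<Longrightarrow> t \<le> d \<Longrightarrow> norm (S t) \<le> M"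
proof -
  have "\<exists>d>0. \<exists>M. \<forall>t. 0 \<le> t \<and> t \<le> d \<longrightarrow> norm (S t) \<le> M"
  proof (rule ccontr)
    assume neg: "\<not> ?thesis"
    have unbounded: "\<exists>t. 0 \<le> t \<and> t \<le> d \<and> K < norm (S t)" if "d > 0" for d K
      using neg that by (meson not_le)
    have "\<exists>t. 0 \<le> t \<and> t \<le> inverse (real (Suc n)) \<and> real n < norm (S t)" for n
      by (rule unbounded) simp
    then obtain t where t: "\<And>n. 0 \<le> t n" "\<And>n. t n \<le> inverse (real (Suc n))"
      "\<And>n. real n < norm (S (t n))" by metis
    have t0: "t \<longlonglongrightarrow> 0"
      by (rule tendsto_sandwich[OF _ _ tendsto_const LIMSEQ_inverse_real_of_nat])
         (use t in auto)
    have "(\<lambda>n. S (t n) f) \<longlonglongrightarrow> f" for f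
    proof -
      have "((\<lambda>t. S t f) \<longlongrightarrow> S 0 f) (at 0 within {0..})"
        using C0_semigroupD(1,3)[OF S] by (simp add: at_within_Ici_at_right)
      then have "continuous (at 0 within {0..}) (\<lambda>t. S t f)"
        by (simp add: continuous_within)
      then have "(\<lambda>n. S (t n) f) \<longlonglongrightarrow> S 0 f"
        using t0 t(1) by (simp add: continuous_within_sequentially comp_def)
      then show ?thesis by (simp add: C0_semigroupD(1)[OF S])
    qed
    then have "bounded (range (\<lambda>n. S (t n) f))" for f
      by (rule convergent_imp_bounded)
    from uniform_boundedness[OF this] obtain M where M: "\<And>n. norm (S (t n)) \<le> M"
      by blast
    obtain n :: nat where "M < n" using reals_Archimedean2 by blast
    with M[of n] t(3)[of n] show False by linarith
  qed
  with that show ?thesis by blast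
qed

text \<open>The semigroup law carries a bound on \<open>[0, d]\<close> over to \<open>[0, n * d]\<close>: one more step of
  length \<open>d\<close> costs one more factor \<open>M\<close>.\<close>

lemma C0_semigroup_locally_bounded:
  fixes S :: "real \<Rightarrow> 'a::banach \<Rightarrow>\<^sub>L 'a"
  assumes S: "C0_semigroup S"
  obtains M where "M \<ge> 0" "\<And>t. 0 \<le> t \<Longrightarrow> t \<le> R \<Longrightarrow> norm (S t) \<le> M"
proof -
  obtain d M where d: "d > 0" and M: "\<And>t. 0 \<le> t \<Longrightarrow> t \<le> d \<Longrightarrow> norm (S t) \<le> M"
    using C0_semigroup_bounded_near_0[OF S] by blast
  have M0: "M \<ge> 0" using order_trans[OF norm_ge_zero M[of 0]] d by simp
  have bound: "\<exists>K. \<forall>t. 0 \<le> t \<and> t \<le> real n * d \<longrightarrow> norm (S t) \<le> K" for n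
  proof (induction n)
    case 0
    then show ?case using M d by (intro exI[of _ M]) auto
  next
    case (Suc n)
    then obtain K where K: "\<And>t. 0 \<le> t \<Longrightarrow> t \<le> real n * d \<Longrightarrow> norm (S t) \<le> K"
      by blast
    have "norm (S t) \<le> max K (M * K)" if t: "0 \<le> t" "t \<le> real (Suc n) * d" for t
    proof (cases "t \<le> real n * d")
      case True
      with K t show ?thesis by (simp add: max.coboundedI1)
    next
      case False
      then have td: "t - real n * d \<le> d" "0 \<le> t - real n * d"
        using t d by (auto simp: algebra_simps)
      have "S (r + s) = S r o\<^sub>L S s" if "0 \<le> r" "0 \<le> s" for r s
        using S that by (simp add: C0_semigroup_def)
      from this[of "t - real n * d" "real n * d"]
      have "S t = S (t - real n * d) o\<^sub>L S (real n * d)"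
        using td d by simp
      then have "norm (S t) \<le> norm (S (t - real n * d)) * norm (S (real n * d))"
        by (simp add: norm_blinfun_compose)
      also have "\<dots> \<le> M * K"
        using M td K[of "real n * d"] d M0 by (intro mult_mono) auto
      finally show ?thesis by simp
    qed
    then show ?case by blast
  qed
  obtain n where "R \<le> real n * d"
    using d by (metis reals_Archimedean3 less_imp_le)
  moreover obtain K where "\<forall>t. 0 \<le> t \<and> t \<le> real n * d \<longrightarrow> norm (S t) \<le> K"
    using bound by blast
  ultimately show ?thesis
    by (intro that[of "max 0 K"]) (auto simp: max.coboundedI2)
qed

text \<open>For \<open>a \<le> b\<close> we have \<open>S b f - S a f = S a (S (b - a) f - f)\<close>, so the local bound reduces
  continuity from either side to right continuity at \<open>0\<close>. Factoring out the earlier of the two times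
  is what makes left continuity work.\<close>

lemma C0_semigroup_continuous_on_orbit:
  fixes S :: "real \<Rightarrow> 'a::banach \<Rightarrow>\<^sub>L 'a"
  assumes S: "C0_semigroup S"
  shows "continuous_on {0..} (\<lambda>t. S t f)"
  unfolding continuous_on_iff
proof (intro ballI allI impI)
  fix t e :: real assume t: "t \<in> {0..}" and e: "0 < e"
  obtain M where M: "M \<ge> 0" "\<And>s. 0 \<le> s \<Longrightarrow> s \<le> t + 1 \<Longrightarrow> norm (S s) \<le> M"
    using C0_semigroup_locally_bounded[OF S] by blast
  have "\<forall>\<^sub>F h in at_right 0. dist (S h f) f < e / (M + 1)"
    using C0_semigroupD(3)[OF S, of f] e M by (auto simp: tendsto_iff)
  then obtain d where d: "d > 0" "\<And>h. 0 < h \<Longrightarrow> h < d \<Longrightarrow> dist (S h f) f < e / (M + 1)"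
    unfolding eventually_at_right_field by blast
  have key: "norm (S b f - S a f) < e" if "0 \<le> a" "a \<le> b" "b \<le> t + 1" "b - a < d" for a b
  proof (cases "a = b")
    case False
    with that have h: "0 < b - a" by simp
    have "S b f - S a f = S a (S (b - a) f - f)"
      using C0_semigroupD(2)[OF S, of a "b - a" f] that by (simp add: blinfun.diff_right)
    then have "norm (S b f - S a f) \<le> norm (S a) * norm (S (b - a) f - f)"
      by (simp add: norm_blinfun)
    also have "\<dots> \<le> M * (e / (M + 1))"
      using M that d(2)[OF h] by (intro mult_mono) (auto simp: dist_norm)
    also have "\<dots> < e"
      using M(1) e by (simp add: field_simps)
    finally show ?thesis .
  qed (use e in simp)
  show "\<exists>d>0. \<forall>s\<in>{0..}. dist s t < d \<longrightarrow> dist (S s f) (S t f) < e"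
  proof (intro exI conjI ballI impI)
    show "min d 1 > 0" using d by simp
    fix s assume s: "s \<in> {0..}" "dist s t < min d 1"
    show "dist (S s f) (S t f) < e"
    proof (cases "s \<le> t")
      case True
      then show ?thesis using key[of s t] s t by (simp add: dist_norm norm_minus_commute)
    next
      case False
      then show ?thesis using key[of t s] s t by (simp add: dist_norm)
    qed
  qed
qed

text \<open>Split \<open>S s y - S t x\<close> into \<open>S s (y - x)\<close>, which the local bound controls uniformly in
  \<open>s\<close>, and \<open>S s x - S t x\<close>, which is continuity of a single orbit.\<close>

lemma C0_semigroup_jointly_continuous:
  fixes S :: "real \<Rightarrow> 'a::banach \<Rightarrow>\<^sub>L 'a"
  assumes S: "C0_semigroup S"
  shows "continuous_on ({0..} \<times> UNIV) (\<lambda>(t, x). S t x)"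
  unfolding continuous_on_iff
proof (intro ballI allI impI)
  fix p :: "real \<times> 'a" and e :: real
  assume "p \<in> {0..} \<times> UNIV" and e: "0 < e"
  then obtain t x where p: "p = (t, x)" and t: "t \<ge> 0" by auto
  obtain M where M: "M \<ge> 0" "\<And>s. 0 \<le> s \<Longrightarrow> s \<le> t + 1 \<Longrightarrow> norm (S s) \<le> M"
    using C0_semigroup_locally_bounded[OF S] by blast
  obtain d where d: "d > 0" "\<And>s. s \<ge> 0 \<Longrightarrow> dist s t < d \<Longrightarrow> dist (S s x) (S t x) < e / 2"
    using C0_semigroup_continuous_on_orbit[OF S, of x, unfolded continuous_on_iff,
        rule_format, of t "e / 2"] t e by auto
  define r where "r = min (min d 1) (e / (2 * (M + 1)))"
  have r: "r > 0" "r \<le> d" "r \<le> 1" "r \<le> e / (2 * (M + 1))"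
    using d e M by (auto simp: r_def)
  show "\<exists>d>0. \<forall>q\<in>{0..} \<times> UNIV. dist q p < d \<longrightarrow>
      dist (case q of (t, x) \<Rightarrow> S t x) (case p of (t, x) \<Rightarrow> S t x) < e"
  proof (intro exI conjI ballI impI)
    fix q :: "real \<times> 'a" assume "q \<in> {0..} \<times> UNIV" and qp: "dist q p < r"
    then obtain s y where q: "q = (s, y)" and s: "s \<ge> 0" by auto
    have st: "dist s t < r" and yx: "dist y x < r"
      using qp dist_fst_le[of q p] dist_snd_le[of q p] by (auto simp: p q)
    have "norm (S s (y - x)) \<le> norm (S s) * norm (y - x)" by (rule norm_blinfun)
    also have "\<dots> \<le> M * (e / (2 * (M + 1)))"
      using M s st yx r by (intro mult_mono) (auto simp: dist_norm)
    also have "\<dots> < e / 2" using M(1) e by (simp add: field_simps)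
    finally have "norm (S s (y - x)) < e / 2" .
    moreover have "norm (S s x - S t x) < e / 2"
      using d(2)[of s] s st r by (auto simp: dist_norm)
    ultimately have "norm (S s (y - x) + (S s x - S t x)) < e"
      using norm_triangle_ineq[of "S s (y - x)" "S s x - S t x"] by linarith
    moreover have "S s y - S t x = S s (y - x) + (S s x - S t x)"
      by (simp add: blinfun.diff_right)
    ultimately have "norm (S s y - S t x) < e" by (simp only:)
    then show "dist (case q of (t, x) \<Rightarrow> S t x) (case p of (t, x) \<Rightarrow> S t x) < e"
      by (simp add: p q dist_norm)
  qed (use r in simp)
qed

section \<open>Duhamel's formula\<close>

text \<open>The mild solution of \<open>u' = A u - g\<close>, \<open>u 0 = f\<close>, where \<open>A\<close> generates \<open>S\<close>. The minus sign
  is that of the delay term moved to the right-hand side.\<close>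

definition duhamel ::
    "(real \<Rightarrow> 'a::banach \<Rightarrow>\<^sub>L 'a) \<Rightarrow> 'a \<Rightarrow> (real \<Rightarrow> 'a) \<Rightarrow> real \<Rightarrow> 'a" where
  "duhamel S f g t = S t f - integral {0..t} (\<lambda>s. S (t - s) (g s))"

lemma duhamel_0: "C0_semigroup S \<Longrightarrow> duhamel S f g 0 = f"
  by (simp add: duhamel_def C0_semigroupD(1))

text \<open>Causality: this is what lets the delay decouple the steps.\<close>

lemma duhamel_cong:
  "(\<And>s. 0 \<le> s \<Longrightarrow> s \<le> t \<Longrightarrow> g s = h s) \<Longrightarrow> duhamel S f g t = duhamel S f h t"
  unfolding duhamel_def by (auto intro!: integral_cong)

text \<open>Here \<open>t\<close> occurs both in the integrand and as a limit of integration, and \<open>S (t - s)\<close> is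
  meaningful only for \<open>s \<le> t\<close>. The substitution \<open>s = t * r\<close> removes both difficulties: the
  interval becomes \<open>[0, 1]\<close>, the time \<open>t - t * r\<close> is never negative, and continuity follows from
  that of parameter-dependent integrals over a fixed interval.\<close>

lemma continuous_on_duhamel:
  assumes S: "C0_semigroup S" and g: "continuous_on {0..} g"
  shows "continuous_on {0..} (duhamel S f g)"
proof -
  have joint: "continuous_on ({0..} \<times> cbox 0 1)
      (\<lambda>(t, r). S (t - t * r) (g (t * r)))" (is "continuous_on ?D _")
  proof -
    have "continuous_on ?D (g \<circ> (\<lambda>p. fst p * snd p))"
      by (intro continuous_on_compose continuous_intros continuous_on_subset[OF g]) auto
    then have "continuous_on ?D (\<lambda>p. (fst p - fst p * snd p, g (fst p * snd p)))"
      by (intro continuous_intros) (simp add: comp_def)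
    then have "continuous_on ?D
        ((\<lambda>(t, x). S t x) \<circ> (\<lambda>p. (fst p - fst p * snd p, g (fst p * snd p))))"
      by (rule continuous_on_compose)
         (auto intro!: continuous_on_subset[OF C0_semigroup_jointly_continuous[OF S]]
               simp: mult_left_le)
    then show ?thesis
      by (simp add: comp_def case_prod_unfold)
  qed
  have scale: "integral {0..t} (\<lambda>s. S (t - s) (g s))
      = t *\<^sub>R integral (cbox 0 1) (\<lambda>r. S (t - t * r) (g (t * r)))" if "t \<in> {0..}" for t
  proof (cases "t = 0")
    case False
    with that have t: "t > 0" by simp
    then have "(\<lambda>s. s / t) ` {0..t} = {0..1}"
      by (simp add: image_divide_atLeastAtMost)
    then show ?thesis
      using integral_stretch_real[of t 0 t "\<lambda>s. S (t - s) (g s)"] t by simp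
  qed simp
  have "continuous_on {0..} (\<lambda>t. S t f
      - t *\<^sub>R integral (cbox 0 1) (\<lambda>r. S (t - t * r) (g (t * r))))"
    by (intro continuous_intros integral_continuous_on_param joint
          C0_semigroup_continuous_on_orbit[OF S])
  then show ?thesis
    by (rule continuous_on_eq) (simp add: duhamel_def scale)
qed

section \<open>The method of steps in a Banach space\<close>

text \<open>The \<open>n\<close>-th iterate solves the delay equation up to time \<open>n * \<tau>\<close>. Beyond that time its
  values have no meaning, but it is kept defined and continuous on all of \<open>[-\<tau>, \<infinity>)\<close>, starting
  from the constant extension of \<open>u0\<close>; so there is nothing to glue when the next iterate is
  formed, apart from the value at time \<open>0\<close>.\<close>

primrec delay_step ::
    "(real \<Rightarrow> 'a::banach \<Rightarrow>\<^sub>L 'a) \<Rightarrow> ('a \<Rightarrow> 'a) \<Rightarrow> real \<Rightarrow> (real \<Rightarrow> 'a) \<Rightarrow> nat \<Rightarrow> real \<Rightarrow> 'a" where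
  "delay_step S B \<tau> u0 0 t = u0 (min t 0)"
| "delay_step S B \<tau> u0 (Suc n) t =
     (if t \<le> 0 then u0 t else duhamel S (u0 0) (\<lambda>s. B (delay_step S B \<tau> u0 n (s - \<tau>))) t)"

lemma continuous_on_delay_step:
  assumes S: "C0_semigroup S" and B: "bounded_linear B"
    and u0: "continuous_on {-\<tau>..0} u0" and \<tau>: "\<tau> > 0"
  shows "continuous_on {-\<tau>..} (delay_step S B \<tau> u0 n)"
proof (induction n)
  case 0
  have "continuous_on {-\<tau>..} (u0 \<circ> (\<lambda>t. min t 0))"
    by (intro continuous_on_compose continuous_intros continuous_on_subset[OF u0])
       (use \<tau> in auto)
  then show ?case by (simp add: comp_def)
next
  case (Suc n)
  let ?g = "\<lambda>s. B (delay_step S B \<tau> u0 n (s - \<tau>))"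
  have "continuous_on {0..} (delay_step S B \<tau> u0 n \<circ> (\<lambda>s. s - \<tau>))"
    by (intro continuous_on_compose continuous_intros continuous_on_subset[OF Suc]) auto
  then have "continuous_on {0..} ?g"
    by (intro bounded_linear.continuous_on[OF B]) (simp add: comp_def)
  then have "continuous_on {0..} (duhamel S (u0 0) ?g)"
    by (rule continuous_on_duhamel[OF S])
  then have "continuous_on ({-\<tau>..0} \<union> {0..})
      (\<lambda>t. if t \<le> 0 then u0 t else duhamel S (u0 0) ?g t)"
    using u0 by (intro continuous_on_If) (auto simp: duhamel_0[OF S])
  moreover have "{-\<tau>..0} \<union> {0..} = {-\<tau>..}" using \<tau> by auto
  ultimately show ?case by simp
qed

text \<open>By causality and the delay, two iterates that agree up to \<open>n * \<tau>\<close> have successors that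
  agree up to \<open>(n + 1) * \<tau>\<close>.\<close>

lemma delay_step_stable:
  assumes \<tau>: "\<tau> > 0"
  shows "t \<le> real n * \<tau> \<Longrightarrow> delay_step S B \<tau> u0 (n + k) t = delay_step S B \<tau> u0 n t"
proof (induction n arbitrary: t)
  case 0
  then show ?case by (cases k) simp_all
next
  case (Suc n)
  then show ?case by (auto intro!: duhamel_cong simp: algebra_simps)
qed

text \<open>The iterates are eventually constant on every bounded interval; their limit is the solution.
  Continuity and the equation at a given time are inherited from one sufficiently late iterate.\<close>

theorem delay_equation_existence:
  assumes S: "C0_semigroup S" and B: "bounded_linear B"
    and u0: "continuous_on {-\<tau>..0} u0" and \<tau>: "\<tau> > 0"
  obtains u where "continuous_on {-\<tau>..} u"
    and "\<And>s. s \<in> {-\<tau>..0} \<Longrightarrow> u s = u0 s"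
    and "\<And>t. t \<ge> 0 \<Longrightarrow> u t = duhamel S (u0 0) (\<lambda>s. B (u (s - \<tau>))) t"
proof
  let ?U = "delay_step S B \<tau> u0"
  \<comment> \<open>The first iterate that is final at time \<open>t\<close>.\<close>
  define u where "u t = ?U (nat \<lceil>t / \<tau>\<rceil>) t" for t
  have u_eq: "u t = ?U n t" if "t \<le> real n * \<tau>" for n t
  proof -
    define m where "m = nat \<lceil>t / \<tau>\<rceil>"
    have "m \<le> n" using that \<tau> by (simp add: m_def ceiling_le_iff pos_divide_le_eq)
    moreover have "t \<le> real m * \<tau>"
      using real_nat_ceiling_ge[of "t / \<tau>"] \<tau> by (simp add: m_def pos_divide_le_eq)
    ultimately show ?thesis
      using delay_step_stable[OF \<tau>, of t m S B u0 "n - m"] by (simp add: u_def m_def)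
  qed
  have archimedean: "\<exists>n. t < real n * \<tau>" for t
    using reals_Archimedean3[OF \<tau>] by blast
  show "continuous_on {-\<tau>..} u"
    unfolding continuous_on_eq_continuous_within
  proof
    fix t assume t: "t \<in> {-\<tau>..}"
    obtain n where n: "t < real n * \<tau>" using archimedean by blast
    have "continuous (at t within {-\<tau>..}) (?U n)"
      using continuous_on_delay_step[OF S B u0 \<tau>] t
      by (simp add: continuous_on_eq_continuous_within)
    then show "continuous (at t within {-\<tau>..}) u"
    proof (rule continuous_transform_within)
      show "0 < real n * \<tau> - t" using n by simp
      show "?U n s = u s" if "dist s t < real n * \<tau> - t" for s
        using that by (intro u_eq[symmetric]) (auto simp: dist_real_def)
    qed (rule t)
  qed
  show "u s = u0 s" if "s \<in> {-\<tau>..0}" for s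
    using that u_eq[of s 0] by (simp add: min_absorb1)
  show "u t = duhamel S (u0 0) (\<lambda>s. B (u (s - \<tau>))) t" if t: "t \<ge> 0" for t
  proof (cases "t = 0")
    case True
    then show ?thesis using u_eq[of 0 0] by (simp add: duhamel_0[OF S])
  next
    case False
    obtain n where n: "t < real n * \<tau>" using archimedean by blast
    have "u t = ?U (Suc n) t" using n \<tau> by (intro u_eq) (simp add: distrib_right)
    also have "\<dots> = duhamel S (u0 0) (\<lambda>s. B (?U n (s - \<tau>))) t"
      using False t by simp
    also have "\<dots> = duhamel S (u0 0) (\<lambda>s. B (u (s - \<tau>))) t"
      using n \<tau> by (intro duhamel_cong) (simp add: u_eq[of _ n])
    finally show ?thesis .
  qed
qed

text \<open>Agreement of two solutions propagates from \<open>[-\<tau>, n * \<tau>]\<close> to \<open>[-\<tau>, (n + 1) * \<tau>]\<close>,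
  because on the longer interval the formula for either solution involves only its values on the
  shorter one.\<close>

theorem delay_equation_uniqueness:
  assumes \<tau>: "\<tau> > 0"
    and init: "\<And>s. s \<in> {-\<tau>..0} \<Longrightarrow> u s = v s"
    and u: "\<And>t. t \<ge> 0 \<Longrightarrow> u t = duhamel S f (\<lambda>s. B (u (s - \<tau>))) t"
    and v: "\<And>t. t \<ge> 0 \<Longrightarrow> v t = duhamel S f (\<lambda>s. B (v (s - \<tau>))) t"
    and t: "t \<ge> -\<tau>"
  shows "u t = v t"
proof -
  have agree: "u t = v t" if "-\<tau> \<le> t" "t \<le> real n * \<tau>" for n t
    using that
  proof (induction n arbitrary: t)
    case 0
    then show ?case using init by simp
  next
    case (Suc n)
    show ?case
    proof (cases "t \<le> 0")
      case True
      then show ?thesis using init Suc.prems by simp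
    next
      case False
      have "duhamel S f (\<lambda>s. B (u (s - \<tau>))) t = duhamel S f (\<lambda>s. B (v (s - \<tau>))) t"
        using Suc by (intro duhamel_cong) (simp add: algebra_simps)
      then show ?thesis using u v False by simp
    qed
  qed
  obtain n where "t < real n * \<tau>" using reals_Archimedean3[OF \<tau>] by blast
  with agree[of t n] t show ?thesis by simp
qed

section \<open>Multiplication by a bounded function on the space of square integrable functions\<close>

lemma square_integrable_mult_L_infty:
  assumes a: "a \<in> borel_measurable lebesgue" and C: "AE x in lebesgue. \<bar>a x\<bar> \<le> C"
    and f: "square_integrable f"
  shows "square_integrable (\<lambda>x. a x * f x)"
    and "(LINT x|lebesgue. (a x * f x)\<^sup>2) \<le> C\<^sup>2 * (LINT x|lebesgue. (f x)\<^sup>2)"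
proof -
  have [measurable]: "a \<in> borel_measurable lebesgue" "f \<in> borel_measurable lebesgue"
    using a f by (auto simp: square_integrable_def)
  have int: "integrable lebesgue (\<lambda>x. C\<^sup>2 * (f x)\<^sup>2)"
    using f by (simp add: square_integrable_def)
  have le: "AE x in lebesgue. (a x * f x)\<^sup>2 \<le> C\<^sup>2 * (f x)\<^sup>2"
    using C
  proof eventually_elim
    case (elim x)
    then have "(a x)\<^sup>2 \<le> C\<^sup>2" using power_mono[of "\<bar>a x\<bar>" C 2] by simp
    then show ?case by (simp add: power_mult_distrib mult_right_mono)
  qed
  have "integrable lebesgue (\<lambda>x. (a x * f x)\<^sup>2)"
    by (rule Bochner_Integration.integrable_bound[OF int]) (use le in auto)
  then show "square_integrable (\<lambda>x. a x * f x)"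
    by (simp add: square_integrable_def)
  show "(LINT x|lebesgue. (a x * f x)\<^sup>2) \<le> C\<^sup>2 * (LINT x|lebesgue. (f x)\<^sup>2)"
    using integral_mono_AE[OF \<open>integrable lebesgue (\<lambda>x. (a x * f x)\<^sup>2)\<close> int le] by simp
qed

text \<open>The product is defined through a chosen representative of the class; any other one may be
  used, because it differs from the chosen one only on a null set.\<close>

lemma mult_L2_abs:
  assumes a: "a \<in> L_infty" and f: "square_integrable f"
  shows "mult_L2 a (abs_L2 f) = abs_L2 (\<lambda>x. a x * f x)"
proof -
  obtain C where C: "a \<in> borel_measurable lebesgue" "AE x in lebesgue. \<bar>a x\<bar> \<le> C"
    using a by (auto simp: L_infty_def)
  have "L2_rel f f" using f by (simp add: L2_rel_def)
  then have "L2_rel (rep_L2 (abs_L2 f)) f"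
    by (rule Quotient3_rep_abs[OF Quotient3_L2])
  then have r: "square_integrable (rep_L2 (abs_L2 f))"
    "AE x in lebesgue. rep_L2 (abs_L2 f) x = f x"
    by (auto simp: L2_rel_def)
  have "L2_rel (\<lambda>x. a x * rep_L2 (abs_L2 f) x) (\<lambda>x. a x * f x)"
    using r(2) square_integrable_mult_L_infty(1)[OF C] r(1) f
    by (auto simp: L2_rel_def)
  then show ?thesis
    unfolding mult_L2_def by (rule Quotient3_rel_abs[OF Quotient3_L2])
qed

lemma bounded_linear_mult_L2:
  assumes a: "a \<in> L_infty"
  shows "bounded_linear (mult_L2 a)"
proof -
  obtain C where C: "a \<in> borel_measurable lebesgue" "AE x in lebesgue. \<bar>a x\<bar> \<le> C"
    using a by (auto simp: L_infty_def)
  note sq = square_integrable_mult_L_infty(1)[OF C]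
  show ?thesis
  proof (rule bounded_linear_intro)
    fix F G :: L2 and c :: real
    obtain f where f: "square_integrable f" "F = abs_L2 f" by (rule L2_exhaust)
    obtain g where g: "square_integrable g" "G = abs_L2 g" by (rule L2_exhaust)
    have plus: "abs_L2 h + abs_L2 k = abs_L2 (\<lambda>x. h x + k x)"
      if "square_integrable h" "square_integrable k" for h k
      using that by (intro plus_L2.abs_eq) (auto simp: L2_rel_def)
    have scale: "c *\<^sub>R abs_L2 h = abs_L2 (\<lambda>x. c * h x)" if "square_integrable h" for h
      using that by (intro scaleR_L2.abs_eq) (auto simp: L2_rel_def)
    show "mult_L2 a (F + G) = mult_L2 a F + mult_L2 a G"
      using f g by (simp add: plus mult_L2_abs[OF a] square_integrable_add sq distrib_left)
    show "mult_L2 a (c *\<^sub>R F) = c *\<^sub>R mult_L2 a F"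
      using f by (simp add: scale mult_L2_abs[OF a] square_integrable_scale sq mult.left_commute)
    have "(norm (mult_L2 a F))\<^sup>2 \<le> C\<^sup>2 * (norm F)\<^sup>2"
      using square_integrable_mult_L_infty(2)[OF C f(1)] f
      by (simp add: mult_L2_abs[OF a] norm_abs_L2_power2(1) sq)
    then have "(norm (mult_L2 a F))\<^sup>2 \<le> (norm F * \<bar>C\<bar>)\<^sup>2"
      by (simp add: power_mult_distrib mult.commute)
    then show "norm (mult_L2 a F) \<le> norm F * \<bar>C\<bar>"
      by (rule power2_le_imp_le) simp
  qed
qed

section \<open>Well-posedness of the delayed equation\<close>

lemma mild_solution_iff_duhamel:
  "mild_solution S lam \<tau> u0 u \<longleftrightarrow>
     continuous_on {-\<tau>..} u \<and> (\<forall>s\<in>{-\<tau>..0}. u s = u0 s) \<and>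
     (\<forall>t\<ge>0. u t = duhamel S (u0 0) (\<lambda>s. mult_L2 lam (u (s - \<tau>))) t)"
  by (simp add: mild_solution_def duhamel_def)

theorem theorem2p2:
  fixes \<tau> :: real
    and lam0 lam :: "real \<Rightarrow> real"
    and u0 :: "real \<Rightarrow> L2"
    and S :: "real \<Rightarrow> (L2 \<Rightarrow>\<^sub>L L2)"
  assumes "\<tau> > 0"
    and "lam0 \<in> L_infty" and "lam \<in> L_infty"
    and "continuous_on {-\<tau>..0} u0"
    and "C0_semigroup S" and "generator S = A_op lam0"
  shows "(\<exists>u. mild_solution S lam \<tau> u0 u) \<and>
         (\<forall>u v. mild_solution S lam \<tau> u0 u \<longrightarrow> mild_solution S lam \<tau> u0 v \<longrightarrow>
            (\<forall>t\<ge>-\<tau>. u t = v t))"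
proof (intro conjI allI impI)
  obtain u where "mild_solution S lam \<tau> u0 u"
    unfolding mild_solution_iff_duhamel
    using delay_equation_existence[OF assms(5) bounded_linear_mult_L2[OF assms(3)] assms(4,1)]
    by metis
  then show "\<exists>u. mild_solution S lam \<tau> u0 u" by blast
  fix u v t
  assume u: "mild_solution S lam \<tau> u0 u" and v: "mild_solution S lam \<tau> u0 v" and t: "-\<tau> \<le> t"
  show "u t = v t"
  proof (rule delay_equation_uniqueness[OF assms(1)])
    show "u s = v s" if "s \<in> {-\<tau>..0}" for s
      using u v that by (simp add: mild_solution_def)
    show "u t = duhamel S (u0 0) (\<lambda>s. mult_L2 lam (u (s - \<tau>))) t" if "t \<ge> 0" for t
      using u that unfolding mild_solution_iff_duhamel by blast
    show "v t = duhamel S (u0 0) (\<lambda>s. mult_L2 lam (v (s - \<tau>))) t" if "t \<ge> 0" for t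
      using v that unfolding mild_solution_iff_duhamel by blast
  qed (rule t)
qed

end
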